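(* Let $B=(b_i)_{i\ge1}$ be a nondecreasing sequence of positive integers. Suppose that $[T,\infty)\subseteq\mathrm{FS}(B)$ for an integer $T\ge1$, and that $\delta_j\to\infty$ as $j\to\infty$. Then $$[T,S_N-T]\subseteq P_N$$ for every sufficiently large $N$.
   Context: Intervals denote sets of integers. For a (finite or infinite) sequence of integers, $\mathrm{FS}$ denotes the set of sums of finite selections of its terms, including the empty sum $0$, each occurrence (index) being used at most once and repeated values counting as separate occurrences. For $B=(b_i)_{i\ge1}$ put $S_j=\sum_{i=1}^j b_i$ (with $S_0=0$), $P_j=\mathrm{FS}(b_1,\ldots,b_j)$ (with $P_0=\{0\}$), and $\delta_j=S_j-b_{j+1}$ (the prefix slack). *)

theory Defs
  imports Complex_Main
begin

text \<open>
  A sequence is a family of integers \<open>b\<close> together with its set \<open>I\<close> of indices, so that equal values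
  at different indices are separate occurrences. An infinite sequence \<open>b\<^sub>1, b\<^sub>2, \<dots>\<close> has index set
  \<open>{1..}\<close>; the value \<open>b 0\<close> is never used.
\<close>

definition FS :: "(nat \<Rightarrow> int) \<Rightarrow> nat set \<Rightarrow> int set" where
  "FS b I = {\<Sum>i\<in>F. b i | F. finite F \<and> F \<subseteq> I}"

definition prefix_sum :: "(nat \<Rightarrow> int) \<Rightarrow> nat \<Rightarrow> int" where
  "prefix_sum b j = (\<Sum>i=1..j. b i)"

definition prefix_FS :: "(nat \<Rightarrow> int) \<Rightarrow> nat \<Rightarrow> int set" where
  "prefix_FS b j = FS b {1..j}"

definition prefix_slack :: "(nat \<Rightarrow> int) \<Rightarrow> nat \<Rightarrow> int" where
  "prefix_slack b j = prefix_sum b j - b (j + 1)"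

end

theory Submission
  imports Defs
begin

text \<open>
  Call \<open>x\<close> missing at \<open>n\<close> if it lies in the interval from \<open>T\<close> to \<open>S\<^sub>n - T\<close> but not in \<open>P\<^sub>n\<close>. Once
  the slack is at least \<open>2 T\<close>, a value missing at \<open>n + 1\<close> yields one missing at \<open>n\<close> by a greedy
  rule: subtract \<open>b\<^sub>n\<^sub>+\<^sub>1\<close> if the result is still at least \<open>T\<close>, and leave the value alone otherwise
  (\<open>missing_descends\<close>). So if nothing is missing at one late \<open>n\<close>, nothing is missing afterwards.
  Otherwise there are missing values at every late level, and since each level has finitely many,
  compactness (\<open>infinite_path_through_finite_levels\<close>) gives one infinite chain \<open>X\<close> in which \<open>X\<^sub>i\<close> is
  missing at \<open>i\<close> and equals \<open>X\<^sub>i\<^sub>-\<^sub>1 + b\<^sub>i\<close> (the index \<open>i\<close> is added), or \<open>X\<^sub>i\<^sub>-\<^sub>1\<close> with \<open>X\<^sub>i\<^sub>-\<^sub>1 < b\<^sub>i + T\<close> (it is skipped).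

  Such a chain cannot exist. Completeness of the whole sequence, and the symmetry of \<open>P\<^sub>n\<close> under
  \<open>x \<mapsto> S\<^sub>n - x\<close>, force infinitely many added and infinitely many skipped indices, and hence
  unbounded terms. At a skipped index \<open>v\<close> followed by an added one, \<open>X\<^sub>v\<close> exceeds \<open>b\<^sub>v\<close> by less
  than \<open>T\<close>. Any representation of \<open>X\<^sub>v\<close> by the whole sequence must use a later term \<open>b\<^sub>s\<close>, and it
  turns out that \<open>b\<^sub>v < b\<^sub>s < b\<^sub>v + T\<close> and that \<open>s\<close> is an added index. Exchanging \<open>b\<^sub>s\<close> for the unused
  \<open>b\<^sub>v\<close> therefore lowers the sum of the added terms by a positive amount less than \<open>T\<close>
  (\<open>positive_gain\<close>). The amounts saved by exchanges further up can be collected until they reach a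
  total \<open>h\<close> with \<open>T \<le> h \<le> T\<^sup>2\<close>, starting above any late skipped index \<open>v\<close> (\<open>large_gain\<close>). As a later
  \<open>X\<^sub>n\<close> is \<open>X\<^sub>v + h\<close> plus a sum of distinct terms with indices between \<open>v\<close> and \<open>n\<close>, the value
  \<open>X\<^sub>v + h\<close> is not in \<open>P\<^sub>v\<close>. But \<open>X\<^sub>v + h - b\<^sub>v\<close> is at least \<open>T\<close>, and less than \<open>b\<^sub>v\<close> when \<open>v\<close> is large, so
  it is a sum of terms before \<open>b\<^sub>v\<close>; adding \<open>b\<^sub>v\<close> is a contradiction (\<open>no_missing_chain\<close>).
\<close>

section \<open>Finite subset sums\<close>

lemma prefix_FS_iff: "x \<in> prefix_FS b n \<longleftrightarrow> (\<exists>F\<subseteq>{1..n}. x = sum b F)"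
  unfolding prefix_FS_def FS_def by (auto intro: finite_subset)

lemma prefix_FS_mono: "m \<le> n \<Longrightarrow> prefix_FS b m \<subseteq> prefix_FS b n"
proof
  fix x assume "m \<le> n" "x \<in> prefix_FS b m"
  then obtain F where "F \<subseteq> {1..m}" "x = sum b F" by (auto simp: prefix_FS_iff)
  moreover have "{1..m} \<subseteq> {1..n}" using \<open>m \<le> n\<close> by auto
  ultimately show "x \<in> prefix_FS b n" unfolding prefix_FS_iff by blast
qed

lemma FS_imp_prefix_FS:
  assumes "x \<in> FS b {1..}"
  shows "\<exists>n. x \<in> prefix_FS b n"
proof -
  obtain F where F: "finite F" "F \<subseteq> {1..}" "x = sum b F"
    using assms by (auto simp: FS_def)
  from F(1) obtain n where "\<forall>i\<in>F. i \<le> n"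
    unfolding finite_nat_set_iff_bounded_le ..
  with F(2) have "F \<subseteq> {1..n}" by auto
  with F(3) show ?thesis by (auto simp: prefix_FS_iff)
qed

lemma prefix_FS_add:
  assumes "x \<in> prefix_FS b m" and "W \<subseteq> {m<..n}" and "m \<le> n"
  shows "x + sum b W \<in> prefix_FS b n"
proof -
  obtain F where F: "F \<subseteq> {1..m}" "x = sum b F"
    using assms(1) by (auto simp: prefix_FS_iff)
  have fin: "finite F" "finite W"
    using F(1) assms(2) by (auto intro: finite_subset)
  have "F \<inter> W = {}" using F(1) assms(2) by force
  then have "x + sum b W = sum b (F \<union> W)"
    using F(2) fin by (simp add: sum.union_disjoint)
  moreover have "F \<union> W \<subseteq> {1..n}" using F(1) assms(2,3) by force
  ultimately show ?thesis unfolding prefix_FS_iff by blast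
qed

lemma prefix_FS_reflect:
  assumes "x \<in> prefix_FS b n"
  shows "prefix_sum b n - x \<in> prefix_FS b n"
proof -
  obtain F where F: "F \<subseteq> {1..n}" "x = sum b F"
    using assms by (auto simp: prefix_FS_iff)
  then have "prefix_sum b n - x = sum b ({1..n} - F)"
    by (simp add: prefix_sum_def sum_diff)
  then show ?thesis unfolding prefix_FS_iff by blast
qed

lemma prefix_sum_Suc: "prefix_sum b (Suc n) = prefix_sum b n + b (Suc n)"
  by (simp add: prefix_sum_def)

section \<open>Infinite paths through finite levels\<close>

text \<open>
  This is Koenig's lemma for a tree whose levels are given as sets. An element with extensions to
  all heights has a successor with the same property: otherwise each of its finitely many
  successors fails at some height, and the element itself fails at the largest of these.
\<close>
lemma infinite_path_through_finite_levels:
  fixes A :: "nat \<Rightarrow> 'a set"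
  assumes fin: "\<And>j. j \<ge> m \<Longrightarrow> finite (A j)"
    and ne: "\<And>j. j \<ge> m \<Longrightarrow> A j \<noteq> {}"
    and pred: "\<And>j y. j \<ge> m \<Longrightarrow> y \<in> A (Suc j) \<Longrightarrow> \<exists>x\<in>A j. R j x y"
  shows "\<exists>f. \<forall>j\<ge>m. f j \<in> A j \<and> R j (f j) (f (Suc j))"
proof -
  define reach where "reach N j x \<longleftrightarrow> (\<exists>f. f j = x \<and> (\<forall>i\<in>{j..N}. f i \<in> A i)
      \<and> (\<forall>i\<in>{j..<N}. R i (f i) (f (Suc i))))" for N j x
  define alive where "alive j x \<longleftrightarrow> x \<in> A j \<and> (\<forall>N\<ge>j. reach N j x)" for j x
  have reach_mono: "reach N j x" if reach: "reach N' j x" and "N \<le> N'" for N N' j x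
  proof -
    obtain f where "f j = x" "\<forall>i\<in>{j..N'}. f i \<in> A i" "\<forall>i\<in>{j..<N'}. R i (f i) (f (Suc i))"
      using reach unfolding reach_def by blast
    with \<open>N \<le> N'\<close> show ?thesis unfolding reach_def by (intro exI[of _ f]) auto
  qed
  have reach_step: "\<exists>y\<in>A (Suc j). R j x y \<and> reach N (Suc j) y" if reach: "reach N j x" and "j < N" for N j x
  proof -
    obtain f where f: "f j = x" "\<forall>i\<in>{j..N}. f i \<in> A i" "\<forall>i\<in>{j..<N}. R i (f i) (f (Suc i))"
      using reach unfolding reach_def by blast
    then have "reach N (Suc j) (f (Suc j))" unfolding reach_def by (intro exI[of _ f]) auto
    with f \<open>j < N\<close> show ?thesis by (intro bexI[of _ "f (Suc j)"]) auto
  qed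
  have select: "\<exists>x\<in>X. \<forall>N\<ge>j. reach N j x"
    if fin_X: "finite X" and some: "\<And>N. N \<ge> j \<Longrightarrow> \<exists>x\<in>X. reach N j x" for X j
  proof (rule ccontr)
    assume "\<not> ?thesis"
    then have "\<forall>x\<in>X. \<exists>N. N \<ge> j \<and> \<not> reach N j x" by blast
    then obtain M where M: "\<forall>x\<in>X. M x \<ge> j \<and> \<not> reach (M x) j x"
      unfolding bchoice_iff ..
    define K where "K = Max (insert j (M ` X))"
    have K: "j \<le> K" "\<And>x. x \<in> X \<Longrightarrow> M x \<le> K"
      using fin_X by (auto simp: K_def)
    then obtain x where "x \<in> X" "reach K j x" using some by blast
    from this(2) K(2)[OF this(1)] have "reach (M x) j x" by (rule reach_mono)
    with M \<open>x \<in> X\<close> show False by simp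
  qed
  have pullback: "\<exists>x\<in>A j. reach N j x" if "m \<le> j" "j \<le> N" for N j
    using that(2,1)
  proof (induction rule: inc_induct)
    case base
    then obtain y where "y \<in> A N" using ne by blast
    then show ?case unfolding reach_def by (intro bexI[of _ y] exI[of _ "\<lambda>_. y"]) auto
  next
    case (step n)
    then obtain y where y: "y \<in> A (Suc n)" "reach N (Suc n) y" by auto
    then obtain f where f: "f (Suc n) = y" "\<forall>i\<in>{Suc n..N}. f i \<in> A i"
        "\<forall>i\<in>{Suc n..<N}. R i (f i) (f (Suc i))"
      unfolding reach_def by blast
    obtain x where x: "x \<in> A n" "R n x y" using pred y(1) step.prems by blast
    have "reach N n x" unfolding reach_def
    proof (intro exI[of _ "f(n := x)"] conjI ballI)
      fix i assume "i \<in> {n..N}"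
      then show "(f(n := x)) i \<in> A i" using f(2) x(1) by (cases "i = n") auto
    next
      fix i assume "i \<in> {n..<N}"
      then show "R i ((f(n := x)) i) ((f(n := x)) (Suc i))"
        using f(1,3) x(2) by (cases "i = n") auto
    qed simp
    with x(1) show ?case by blast
  qed
  have start: "\<exists>x. alive m x"
  proof -
    have "\<exists>x\<in>A m. \<forall>N\<ge>m. reach N m x"
      by (rule select) (use fin pullback in simp_all)
    then show ?thesis unfolding alive_def by blast
  qed
  have next_alive: "\<exists>y. alive (Suc j) y \<and> R j x y" if "alive j x" "m \<le> j" for j x
  proof -
    have "\<exists>y\<in>{y \<in> A (Suc j). R j x y}. reach N (Suc j) y" if "N \<ge> Suc j" for N
      using reach_step[of N j x] \<open>alive j x\<close> that unfolding alive_def by auto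
    then have "\<exists>y\<in>{y \<in> A (Suc j). R j x y}. \<forall>N\<ge>Suc j. reach N (Suc j) y"
      by (intro select) (use fin[of "Suc j"] that(2) in simp_all)
    then show ?thesis unfolding alive_def by blast
  qed
  have "\<exists>f. \<forall>n. alive (m + n) (f n) \<and> R (m + n) (f n) (f (Suc n))"
  proof (rule dependent_nat_choice)
    show "\<exists>x. alive (m + 0) x" using start by simp
    show "\<exists>y. alive (m + Suc n) y \<and> R (m + n) x y" if "alive (m + n) x" for x n
      using next_alive[OF that] by simp
  qed
  then obtain f where f: "\<And>n. alive (m + n) (f n)" "\<And>n. R (m + n) (f n) (f (Suc n))" by blast
  show ?thesis
  proof (intro exI[of _ "\<lambda>j. f (j - m)"] allI impI conjI)
    fix j assume "m \<le> j"
    then show "f (j - m) \<in> A j" "R j (f (j - m)) (f (Suc j - m))"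
      using f(1)[of "j - m"] f(2)[of "j - m"] by (auto simp: alive_def Suc_diff_le)
  qed
qed

section \<open>Missing values of a sequence that represents all large integers\<close>

locale eventually_complete =
  fixes b :: "nat \<Rightarrow> int" and T :: int
  assumes mono: "mono_on {1..} b"
    and pos: "\<And>i. i \<ge> 1 \<Longrightarrow> b i > 0"
    and T_pos: "T \<ge> 1"
    and complete: "{T..} \<subseteq> FS b {1..}"
begin

lemma b_mono: "1 \<le> i \<Longrightarrow> i \<le> j \<Longrightarrow> b i \<le> b j"
  using mono by (auto simp: mono_on_def)

lemma term_le_sum:
  assumes "finite F" "F \<subseteq> {1..}" "s \<in> F"
  shows "b s \<le> sum b F"
  by (rule member_le_sum) (use assms pos in \<open>force simp: less_imp_le\<close>)+

lemma two_terms_le_sum: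
  assumes "finite F" "F \<subseteq> {1..}" "s \<in> F" "t \<in> F" "s \<noteq> t"
  shows "b s + b t \<le> sum b F"
proof -
  have "sum b F = b s + sum b (F - {s})" using assms by (simp add: sum.remove)
  moreover have "b t \<le> sum b (F - {s})" using assms by (intro term_le_sum) auto
  ultimately show ?thesis by simp
qed

lemma late_term:
  assumes "T \<le> x" and "x \<notin> prefix_FS b n"
  obtains F s where "finite F" "F \<subseteq> {1..}" "x = sum b F" "s \<in> F" "n < s"
proof -
  obtain F where F: "finite F" "F \<subseteq> {1..}" "x = sum b F"
    using assms(1) complete by (force simp: FS_def)
  then have "\<not> F \<subseteq> {1..n}" using assms(2) by (auto simp: prefix_FS_iff)
  then obtain s where "s \<in> F" "n < s" using F(2) by force
  with F that show ?thesis by blast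
qed

text \<open>
  A number that the whole sequence represents and the first \<open>n\<close> terms do not must use a later term,
  and the sequence is nondecreasing. Read the other way round, \<open>P\<^sub>n\<close> contains every number from
  \<open>T\<close> up to \<open>b\<^sub>n\<^sub>+\<^sub>1 - 1\<close>.
\<close>
lemma missing_ge_next_term:
  assumes "T \<le> x" and "x \<notin> prefix_FS b n"
  shows "b (Suc n) \<le> x"
proof -
  obtain F s where F: "finite F" "F \<subseteq> {1..}" "x = sum b F" "s \<in> F" "n < s"
    using late_term assms by blast
  then have "b (Suc n) \<le> b s" using b_mono by auto
  with term_le_sum[OF F(1,2,4)] F(3) show ?thesis by simp
qed

definition missing :: "nat \<Rightarrow> int set" where
  "missing n = {T..prefix_sum b n - T} - prefix_FS b n"

text \<open>
  The side condition in the second case records that the greedy descent leaves a value unchanged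
  only when subtracting the term would push it below \<open>T\<close>. It is what ties a skipped term to the
  size of the chain.
\<close>
definition greedy_step :: "nat \<Rightarrow> int \<Rightarrow> int \<Rightarrow> bool" where
  "greedy_step n x y \<longleftrightarrow> y = x + b (Suc n) \<or> y = x \<and> x < b (Suc n) + T"

text \<open>
  The slack is needed when the value \<open>y\<close> is left unchanged: then \<open>y < b\<^sub>n\<^sub>+\<^sub>1 + T\<close>, and
  \<open>b\<^sub>n\<^sub>+\<^sub>1 + T \<le> S\<^sub>n - T\<close> keeps it inside the smaller interval.
\<close>
lemma missing_descends:
  assumes "prefix_slack b n \<ge> 2 * T" and y: "y \<in> missing (Suc n)"
  shows "\<exists>x\<in>missing n. greedy_step n x y"
proof (cases "y \<ge> b (Suc n) + T")
  case True
  have "y - b (Suc n) \<notin> prefix_FS b n"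
    using prefix_FS_add[of "y - b (Suc n)" b n "{Suc n}" "Suc n"] y by (auto simp: missing_def)
  with True y show ?thesis
    by (intro bexI[of _ "y - b (Suc n)"]) (auto simp: missing_def greedy_step_def prefix_sum_Suc)
next
  case False
  have "y \<notin> prefix_FS b n" using y prefix_FS_mono[of n "Suc n" b] by (auto simp: missing_def)
  with False y assms(1) show ?thesis
    by (intro bexI[of _ y]) (auto simp: missing_def greedy_step_def prefix_slack_def)
qed

end

section \<open>An infinite greedy chain of missing values\<close>

locale missing_chain = eventually_complete +
  fixes X :: "nat \<Rightarrow> int" and m\<^sub>0 :: nat
  assumes chain_missing: "\<And>j. m\<^sub>0 \<le> j \<Longrightarrow> X j \<in> missing j"
    and chain_step: "\<And>j. m\<^sub>0 \<le> j \<Longrightarrow> greedy_step j (X j) (X (Suc j))"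
begin

definition added :: "nat \<Rightarrow> bool" where
  "added i \<longleftrightarrow> X i = X (i - 1) + b i"

lemma chain_ge: "m\<^sub>0 \<le> j \<Longrightarrow> T \<le> X j"
  and chain_not_prefix: "m\<^sub>0 \<le> j \<Longrightarrow> X j \<notin> prefix_FS b j"
  and chain_le: "m\<^sub>0 \<le> j \<Longrightarrow> X j \<le> prefix_sum b j - T"
  using chain_missing by (auto simp: missing_def)

lemma skipped:
  assumes "m\<^sub>0 < i" and "\<not> added i"
  shows "X i = X (i - 1)" and "X i < b i + T"
  using chain_step[of "i - 1"] assms by (auto simp: greedy_step_def added_def)

lemma chain_mono:
  assumes "m\<^sub>0 \<le> m" and "m \<le> n"
  shows "X m \<le> X n"
  using assms(2)
proof (induction rule: dec_induct)
  case (step i)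
  then show ?case using chain_step[of i] pos[of "Suc i"] assms(1) by (auto simp: greedy_step_def)
qed simp

lemma chain_sum:
  assumes "m\<^sub>0 \<le> m" and "m \<le> n"
  shows "X n = X m + sum b {i \<in> {m<..n}. added i}"
  using assms(2)
proof (induction rule: dec_induct)
  case (step i)
  show ?case
  proof (cases "added (Suc i)")
    case True
    have "{k \<in> {m<..Suc i}. added k} = insert (Suc i) {k \<in> {m<..i}. added k}"
      using True step.hyps by (auto simp: le_Suc_eq)
    then have "sum b {k \<in> {m<..Suc i}. added k} = b (Suc i) + sum b {k \<in> {m<..i}. added k}"
      by simp
    then show ?thesis using True step.IH by (simp add: added_def)
  next
    case False
    have "{k \<in> {m<..Suc i}. added k} = {k \<in> {m<..i}. added k}"
      using False by (auto simp: le_Suc_eq)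
    moreover have "X (Suc i) = X i" using skipped(1)[of "Suc i"] False step.hyps assms(1) by simp
    ultimately show ?thesis using step.IH by simp
  qed
qed simp

text \<open>
  Without further added indices the chain is constant; its value is at least \<open>T\<close>, so it is
  represented by finitely many terms and cannot be missing for ever.
\<close>
lemma added_infinitely_often: "\<exists>i>n. added i"
proof (rule ccontr)
  assume no: "\<not> ?thesis"
  define m where "m = max n m\<^sub>0"
  have const: "X k = X m" if "m \<le> k" for k
  proof -
    have none: "{i \<in> {m<..k}. added i} = {}" using no by (auto simp: m_def)
    have "X k = X m + sum b {i \<in> {m<..k}. added i}"
      by (rule chain_sum) (use that in \<open>simp_all add: m_def\<close>)
    then show ?thesis unfolding none by simp
  qed
  have "X m \<in> FS b {1..}" using chain_ge[of m] complete by (auto simp: m_def)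
  then obtain k where "X m \<in> prefix_FS b k" using FS_imp_prefix_FS by blast
  then have "X m \<in> prefix_FS b (max k m)" using prefix_FS_mono[of k "max k m"] by auto
  moreover have "X (max k m) \<notin> prefix_FS b (max k m)" by (rule chain_not_prefix) (simp add: m_def)
  ultimately show False using const[of "max k m"] by simp
qed

text \<open>
  This is the mirror image: without further skipped indices the complement \<open>S\<^sub>k - X\<^sub>k\<close> is constant,
  and it is represented by \<open>P\<^sub>k\<close> exactly when \<open>X\<^sub>k\<close> is.
\<close>
lemma skipped_infinitely_often: "\<exists>i>n. \<not> added i"
proof (rule ccontr)
  assume no: "\<not> ?thesis"
  define m where "m = max n m\<^sub>0"
  define y where "y = prefix_sum b m - X m"
  have const: "prefix_sum b k - X k = y" if "m \<le> k" for k
    using that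
  proof (induction rule: dec_induct)
    case (step i)
    then have "added (Suc i)" using no by (auto simp: m_def)
    with step.IH show ?case by (simp add: added_def prefix_sum_Suc)
  qed (simp add: y_def)
  have "y \<in> FS b {1..}" using chain_le[of m] complete by (auto simp: m_def y_def)
  then obtain k where "y \<in> prefix_FS b k" using FS_imp_prefix_FS by blast
  then have "y \<in> prefix_FS b (max k m)" using prefix_FS_mono[of k "max k m"] by auto
  then have "prefix_sum b (max k m) - y \<in> prefix_FS b (max k m)" by (rule prefix_FS_reflect)
  moreover have "X (max k m) \<notin> prefix_FS b (max k m)" by (rule chain_not_prefix) (simp add: m_def)
  moreover have "prefix_sum b (max k m) - y = X (max k m)" using const[of "max k m"] by simp
  ultimately show False by simp
qed

lemma chain_unbounded: "\<exists>j\<ge>m\<^sub>0. int c \<le> X j"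
proof (induction c)
  case 0
  then show ?case using chain_ge[of "m\<^sub>0"] T_pos by (intro exI[of _ "m\<^sub>0"]) auto
next
  case (Suc c)
  then obtain j where j: "m\<^sub>0 \<le> j" "int c \<le> X j" by blast
  obtain i where i: "i > j" "added i" using added_infinitely_often by blast
  have "X j \<le> X (i - 1)" using chain_mono j i by simp
  then have "int (Suc c) \<le> X i" using i j pos[of i] by (simp add: added_def)
  then show ?case using i j by (intro exI[of _ i]) simp
qed

text \<open>
  The chain grows without bound because it adds positive integers infinitely often, yet it stays
  below \<open>b\<^sub>v + T\<close> at each skipped index \<open>v\<close>.
\<close>
lemma terms_unbounded: "\<exists>m\<ge>m\<^sub>0. \<forall>i>m. c \<le> b i"
proof -
  obtain j where j: "m\<^sub>0 \<le> j" "int (nat (c + T)) \<le> X j" using chain_unbounded by blast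
  obtain v where v: "v > j" "\<not> added v" using skipped_infinitely_often by blast
  have "X j \<le> X v" using chain_mono j v by simp
  then have "c \<le> b v" using skipped(2)[of v] v j by linarith
  have "c \<le> b i" if "i > v" for i
    using b_mono[of v i] \<open>c \<le> b v\<close> that v by linarith
  with v j show ?thesis by (intro exI[of _ v]) simp
qed

text \<open>
  The increase of the chain from \<open>m\<close> to \<open>n\<close> is the sum of the added terms in between. A gain is
  what is left over when that increase is paid with another selection \<open>W\<close> of terms from the same
  range of indices.
\<close>
definition gain :: "nat \<Rightarrow> nat \<Rightarrow> int \<Rightarrow> bool" where
  "gain m n h \<longleftrightarrow> m \<le> n \<and> (\<exists>W\<subseteq>{m<..n}. X n = X m + h + sum b W)"

lemma gain_refl: "gain m m 0"
  by (auto simp: gain_def)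

lemma gain_trans:
  assumes "gain l m h" and "gain m n h'"
  shows "gain l n (h + h')"
proof -
  obtain W W' where W: "W \<subseteq> {l<..m}" "X m = X l + h + sum b W" "l \<le> m"
    and W': "W' \<subseteq> {m<..n}" "X n = X m + h' + sum b W'" "m \<le> n"
    using assms by (auto simp: gain_def)
  have "W \<inter> W' = {}" using W W' by force
  moreover have "finite W" "finite W'" using W(1) W'(1) by (auto intro: finite_subset)
  ultimately have "X n = X l + (h + h') + sum b (W \<union> W')"
    using W W' by (simp add: sum.union_disjoint)
  moreover have "W \<union> W' \<subseteq> {l<..n}" using W W' by force
  ultimately show ?thesis using W(3) W'(3) unfolding gain_def
    by (intro conjI exI[of _ "W \<union> W'"]) auto
qed

lemma gain_not_prefix:
  assumes "m\<^sub>0 \<le> m" and "gain m n h"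
  shows "X m + h \<notin> prefix_FS b m"
proof
  assume *: "X m + h \<in> prefix_FS b m"
  obtain W where "m \<le> n" "W \<subseteq> {m<..n}" "X n = X m + h + sum b W"
    using assms(2) by (auto simp: gain_def)
  with * have "X n \<in> prefix_FS b n" using prefix_FS_add by metis
  with chain_not_prefix[of n] assms(1) \<open>m \<le> n\<close> show False by simp
qed

lemma swap_gain:
  assumes "m\<^sub>0 \<le> m" "m < v" "v < s" "\<not> added v" "added s"
  shows "gain m s (b s - b v)"
proof -
  let ?U = "{i \<in> {m<..s}. added i}"
  let ?W = "insert v (?U - {s})"
  have "sum b ?U = b s + sum b (?U - {s})" using assms by (intro sum.remove) auto
  moreover have "sum b ?W = b v + sum b (?U - {s})" using assms by (intro sum.insert) auto
  ultimately have "X s = X m + (b s - b v) + sum b ?W" using chain_sum[of m s] assms by simp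
  moreover have "?W \<subseteq> {m<..s}" using assms by auto
  ultimately show ?thesis using assms unfolding gain_def by (intro conjI exI[of _ ?W]) auto
qed

text \<open>
  The exchange takes place around a skipped index \<open>v\<close> whose successor \<open>u\<close> is added. A representation
  of \<open>X\<^sub>v\<close> uses some \<open>s > v\<close>, and because \<open>X\<^sub>v < b\<^sub>v + T \<le> 2 b\<^sub>v\<close> all its other indices lie before \<open>v\<close>.
  If \<open>b\<^sub>s = b\<^sub>v\<close>, then using \<open>v\<close> instead of \<open>s\<close> would represent \<open>X\<^sub>v\<close> in \<open>P\<^sub>v\<close>. The index \<open>s\<close> is added
  because after adding \<open>b\<^sub>u\<close> the chain is already at least \<open>2 b\<^sub>v\<close>, too large for a term as
  small as \<open>b\<^sub>s\<close> to be skipped.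
\<close>
lemma positive_gain:
  assumes m: "m\<^sub>0 \<le> m" and large: "\<forall>i>m. 2 * T \<le> b i"
  shows "\<exists>n h. gain m n h \<and> 1 \<le> h \<and> h \<le> T"
proof -
  obtain w where w: "m < w" "\<not> added w" using skipped_infinitely_often by blast
  obtain u' where "w < u'" "added u'" using added_infinitely_often by blast
  \<comment> \<open>Taking the first added index after \<open>w\<close> makes its predecessor a skipped one.\<close>
  define u where "u = (LEAST u. w < u \<and> added u)"
  have u: "w < u" "added u"
    unfolding u_def using LeastI[of "\<lambda>u. w < u \<and> added u" u'] \<open>w < u'\<close> \<open>added u'\<close> by auto
  define v where "v = u - 1"
  have v: "m < v" "u = Suc v" "\<not> added v"
  proof -
    show "m < v" "u = Suc v" using u w by (auto simp: v_def)
    show "\<not> added v"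
    proof (cases "v = w")
      case False
      then have "w < v" "v < u" using u by (auto simp: v_def)
      then show ?thesis unfolding u_def using not_less_Least by blast
    qed (use w in simp)
  qed
  have Xv: "X v < b v + T" using skipped(2) v m by simp
  have bv: "2 * T \<le> b v" using large v by blast
  obtain F s where F: "finite F" "F \<subseteq> {1..}" "X v = sum b F" "s \<in> F" "v < s"
    using late_term[of "X v" v] chain_ge[of v] chain_not_prefix[of v] v m by auto
  have bs_ge: "b v \<le> b s" using b_mono F v by simp
  have bs_less: "b s < b v + T" using term_le_sum[OF F(1,2,4)] F(3) Xv by simp
  have others: "t < v" if "t \<in> F" "t \<noteq> s" for t
  proof (rule ccontr)
    assume "\<not> t < v"
    then have "b v \<le> b t" using b_mono[of v t] v by simp
    moreover have "b s + b t \<le> X v" using two_terms_le_sum[of F s t] F that by simp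
    ultimately show False using bs_ge bv Xv T_pos by simp
  qed
  have "b s \<noteq> b v"
  proof
    assume eq: "b s = b v"
    let ?F = "insert v (F - {s})"
    have "v \<notin> F - {s}" using others by blast
    then have "sum b ?F = sum b F" using F eq by (simp add: sum.remove)
    moreover have "?F \<subseteq> {1..v}" using others F(2) v(1) by force
    ultimately have "X v \<in> prefix_FS b v" using F(3) by (metis prefix_FS_iff)
    then show False using chain_not_prefix[of v] v m by simp
  qed
  have "added s"
  proof (cases "s = u")
    case False
    show ?thesis
    proof (rule ccontr)
      assume "\<not> added s"
      then have s: "X s < b s + T" using skipped(2)[of s] F v m by simp
      have "X u = X v + b u" using u(2) v(2) by (simp add: added_def)
      moreover have "b u \<le> X v"
        using missing_ge_next_term[of "X v" v] chain_ge[of v] chain_not_prefix[of v] v m by simp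
      moreover have "b v \<le> b u" using b_mono[of v u] v by simp
      moreover have "X u \<le> X s" using chain_mono[of u s] F v m False by simp
      ultimately show False using s bs_less bv by simp
    qed
  qed (use u in simp)
  then have "gain m s (b s - b v)" using swap_gain m v F by simp
  then show ?thesis using bs_ge \<open>b s \<noteq> b v\<close> bs_less by (intro exI[of _ s] exI[of _ "b s - b v"]) auto
qed

lemma large_gain:
  assumes "m\<^sub>0 \<le> m" and "\<forall>i>m. 2 * T \<le> b i"
  shows "\<exists>n h. gain m n h \<and> int c \<le> h \<and> h \<le> int c * T"
proof (induction c)
  case 0
  then show ?case using gain_refl by (intro exI[of _ m] exI[of _ 0]) simp
next
  case (Suc c)
  then obtain n h where h: "gain m n h" "int c \<le> h" "h \<le> int c * T" by blast
  then have "m \<le> n" by (simp add: gain_def)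
  then obtain k h' where h': "gain n k h'" "1 \<le> h'" "h' \<le> T"
    using positive_gain[of n] assms by auto
  have "gain m k (h + h')" using gain_trans h h' by blast
  then show ?case using h h'
    by (intro exI[of _ k] exI[of _ "h + h'"]) (auto simp: algebra_simps)
qed

lemma no_missing_chain: False
proof -
  \<comment> \<open>The remainder \<open>r\<close> below is less than \<open>T + T * T\<close> and has to stay under \<open>b v\<close>.\<close>
  obtain m where m: "m\<^sub>0 \<le> m" "\<forall>i>m. T + T * T \<le> b i" using terms_unbounded by blast
  obtain v where v: "m < v" "\<not> added v" using skipped_infinitely_often by blast
  have bv: "T + T * T \<le> b v" using m v by blast
  have "2 * T \<le> b i" if "i > v" for i
  proof -
    have "T \<le> T * T" using T_pos by simp
    moreover have "T + T * T \<le> b i" using m(2) v(1) that by simp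
    ultimately show ?thesis by linarith
  qed
  then obtain n h where h: "gain v n h" "T \<le> h" "h \<le> T * T"
    using large_gain[of v "nat T"] m v T_pos by auto
  define r where "r = X v - b v + h"
  have X: "X v < b v + T" using skipped(2) v m by simp
  have "X v = X (v - 1)" using skipped(1) v m by simp
  then have "b v \<le> X v"
    using missing_ge_next_term[of "X (v - 1)" "v - 1"] chain_ge[of "v - 1"]
      chain_not_prefix[of "v - 1"] v m by simp
  then have r: "T \<le> r" "r < b v" using X h bv T_pos by (auto simp: r_def)
  have "r \<in> prefix_FS b (v - 1)" using missing_ge_next_term[of r "v - 1"] r v by fastforce
  then have "r + sum b {v} \<in> prefix_FS b v"
    using prefix_FS_add[of r b "v - 1" "{v}" v] v by auto
  then have "X v + h \<in> prefix_FS b v" by (simp add: r_def)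
  with gain_not_prefix[of v n h] h v m show False by simp
qed

end

section \<open>Intervals of prefix sums\<close>

theorem theorem2:
  fixes b :: "nat \<Rightarrow> int" and T :: int
  assumes "mono_on {1..} b"
    and "\<And>i. i \<ge> 1 \<Longrightarrow> b i > 0"
    and "T \<ge> 1"
    and "{T..} \<subseteq> FS b {1..}"
    and "filterlim (prefix_slack b) at_top sequentially"
  shows "\<forall>\<^sub>F N in sequentially. {T..prefix_sum b N - T} \<subseteq> prefix_FS b N"
proof -
  interpret eventually_complete b T
    using assms(1-4) by unfold_locales auto
  have "\<forall>\<^sub>F n in sequentially. 2 * T \<le> prefix_slack b n"
    using assms(5) by (simp add: filterlim_at_top)
  then obtain m where m: "\<And>n. n \<ge> m \<Longrightarrow> 2 * T \<le> prefix_slack b n"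
    by (auto simp: eventually_sequentially)
  have "\<exists>k\<ge>m. missing k = {}"
  proof (rule ccontr)
    assume "\<not> ?thesis"
    then have "\<exists>X. \<forall>j\<ge>m. X j \<in> missing j \<and> greedy_step j (X j) (X (Suc j))"
      using m missing_descends
      by (intro infinite_path_through_finite_levels) (auto simp: missing_def)
    then obtain X where "\<forall>j\<ge>m. X j \<in> missing j \<and> greedy_step j (X j) (X (Suc j))" by blast
    then interpret missing_chain b T X m by unfold_locales auto
    show False by (rule no_missing_chain)
  qed
  then obtain k where k: "m \<le> k" "missing k = {}" by blast
  have "missing n = {}" if "k \<le> n" for n
    using that
  proof (induction rule: dec_induct)
    case (step n)
    then show ?case using missing_descends[of n] m[of n] k by auto
  qed (fact k)
  then show ?thesis
    unfolding eventually_sequentially by (intro exI[of _ k]) (auto simp: missing_def)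
qed

end
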